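(* Let $p$ be a prime and $z\in\mathbb{Z}_p$. Then the limit $\mu_p(z,1)=\lim_{n\to\infty}F_n(z,1)$ exists and equals $\frac{1}{p+1}$.
   Context: The Calkin--Wilf tree is the infinite rooted binary tree generated from the root $\frac11$ by giving each vertex labelled $\frac ab$ (reduced) a left child $\frac{a}{a+b}$ and a right child $\frac{a+b}{b}$; its $n$th generation $\mathcal{CW}^{(n)}$ is the multiset of the $2^{n-1}$ labels at distance $n-1$ from the root. For a prime $p$, $z\in\mathbb{Q}_p$ and $\nu\in\mathbb{Z}$, put $F_n(z,\nu)=2^{1-n}\#\{\frac ab\in\mathcal{CW}^{(n)}:\ \mathrm{ord}_p(\frac ab-z)\ge\nu\}$, where $\mathrm{ord}_p$ is the $p$-adic valuation (with $\mathrm{ord}_p(0)=+\infty$), and $\mu_p(z,\nu)=\lim_{n\to\infty}F_n(z,\nu)$. *)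

theory Defs
  imports "HOL-Analysis.Analysis" "HOL-Computational_Algebra.Primes"
begin

section \<open>The Calkin--Wilf tree\<close>

definition cw_left :: "rat \<Rightarrow> rat" where
  "cw_left q = (case quotient_of q of (a, b) \<Rightarrow> Rat.Fract a (a + b))"

definition cw_right :: "rat \<Rightarrow> rat" where
  "cw_right q = (case quotient_of q of (a, b) \<Rightarrow> Rat.Fract (a + b) b)"

text \<open>Vertices of the infinite rooted binary tree are lists of booleans: the root is the
  empty list, and the left and right child of \<open>v\<close> are \<open>False # v\<close> and \<open>True # v\<close>.
  The distance of \<open>v\<close> from the root is \<open>length v\<close>.\<close>

fun cw_label :: "bool list \<Rightarrow> rat" where
  "cw_label [] = 1"
| "cw_label (d # v) = (if d then cw_right (cw_label v) else cw_left (cw_label v))"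

text \<open>Generations are numbered from 1; generation 0 is empty.\<close>

definition cw_generation :: "nat \<Rightarrow> rat multiset" where
  "cw_generation n = image_mset cw_label (mset_set {v. length v + 1 = n})"

section \<open>The \<open>p\<close>-adic valuation on the rational numbers\<close>

definition rat_ord :: "nat \<Rightarrow> rat \<Rightarrow> ereal" where
  "rat_ord p q = (if q = 0 then \<infinity> else case quotient_of q of (a, b) \<Rightarrow>
     ereal (real (multiplicity (int p) a) - real (multiplicity (int p) b)))"

lemma rat_ord_0 [simp]: "rat_ord p 0 = \<infinity>"
  by (simp add: rat_ord_def)

lemma rat_ord_divide:
  assumes p: "prime p" and ab: "a \<noteq> 0" "b \<noteq> 0"
  shows "rat_ord p (of_int a / of_int b)
           = ereal (real (multiplicity (int p) a) - real (multiplicity (int p) b))"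
proof -
  obtain c d where cd: "quotient_of (of_int a / of_int b) = (c, d)" by fastforce
  have d: "d > 0" using quotient_of_denom_pos[OF cd] .
  have eq: "(of_int a / of_int b :: rat) = of_int c / of_int d"
    using quotient_of_div[OF cd] .
  have c: "c \<noteq> 0" using eq ab d by auto
  have "(of_int (a * d) :: rat) = of_int (c * b)"
    using eq ab d by (simp add: field_simps)
  then have *: "a * d = c * b" by (simp only: of_int_eq_iff)
  have pp: "prime_elem (int p)" using p by simp
  have "multiplicity (int p) a + multiplicity (int p) d
          = multiplicity (int p) c + multiplicity (int p) b"
    using arg_cong[OF *, of "multiplicity (int p)"] pp ab c d
    by (simp add: prime_elem_multiplicity_mult_distrib)
  then have "real (multiplicity (int p) a) + real (multiplicity (int p) d)
          = real (multiplicity (int p) c) + real (multiplicity (int p) b)"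
    by linarith
  then show ?thesis using ab cd by (simp add: rat_ord_def)
qed

lemma rat_ord_minus [simp]: "rat_ord p (- q) = rat_ord p q"
proof -
  have "multiplicity (int p) (- a) = multiplicity (int p) a" for a
    by (rule multiplicity_cong) simp
  then show ?thesis by (auto simp: rat_ord_def rat_uminus_code split: prod.splits)
qed

lemma rat_ord_diff_commute: "rat_ord p (x - y) = rat_ord p (y - x)"
  using rat_ord_minus[of p "x - y"] by simp

lemma rat_ord_add:
  assumes p: "prime p"
  shows "rat_ord p (x + y) \<ge> min (rat_ord p x) (rat_ord p y)"
proof (cases "x = 0 \<or> y = 0 \<or> x + y = 0")
  case True
  then show ?thesis by auto
next
  case False
  obtain a b where ab: "quotient_of x = (a, b)" by fastforce
  obtain c d where cd: "quotient_of y = (c, d)" by fastforce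
  have pos: "b > 0" "d > 0"
    using quotient_of_denom_pos[OF ab] quotient_of_denom_pos[OF cd] .
  have x: "x = of_int a / of_int b" and y: "y = of_int c / of_int d"
    using quotient_of_div[OF ab] quotient_of_div[OF cd] .
  have nz: "a \<noteq> 0" "c \<noteq> 0" using False x y by auto
  have s: "x + y = of_int (a * d + c * b) / of_int (b * d)"
    using pos x y by (simp add: field_simps)
  have snz: "a * d + c * b \<noteq> 0"
    using False unfolding s by (metis div_0 of_int_0)
  let ?m = "multiplicity (int p)"
  have pp: "prime_elem (int p)" and nu: "\<not> is_unit (int p)"
    using p by (auto simp: prime_elem_not_unit)
  have m1: "?m (a * d) = ?m a + ?m d" "?m (c * b) = ?m c + ?m b" "?m (b * d) = ?m b + ?m d"
    using pp pos nz by (simp_all add: prime_elem_multiplicity_mult_distrib)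
  let ?k = "min (?m a + ?m d) (?m c + ?m b)"
  have "int p ^ ?k dvd a * d" "int p ^ ?k dvd c * b"
    using m1 by (auto intro!: multiplicity_dvd')
  then have "int p ^ ?k dvd a * d + c * b" by simp
  then have k: "?k \<le> ?m (a * d + c * b)"
    using snz nu by (intro multiplicity_geI)
  have "rat_ord p (x + y) = ereal (real (?m (a * d + c * b)) - real (?m (b * d)))"
    unfolding s using pos snz by (intro rat_ord_divide[OF p]) auto
  moreover have "rat_ord p x = ereal (real (?m a) - real (?m b))"
    unfolding x using pos nz by (intro rat_ord_divide[OF p]) auto
  moreover have "rat_ord p y = ereal (real (?m c) - real (?m d))"
    unfolding y using pos nz by (intro rat_ord_divide[OF p]) auto
  ultimately show ?thesis using k m1 by (auto simp: min_def split: if_splits)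
qed

lemma rat_ord_add_ge:
  assumes "prime p" "rat_ord p x \<ge> v" "rat_ord p y \<ge> v"
  shows "rat_ord p (x + y) \<ge> v"
  using rat_ord_add[OF assms(1), of x y] assms(2,3) by (meson min.boundedI order_trans)

lemma rat_ord_diff_ge:
  assumes "prime p" "rat_ord p x \<ge> v" "rat_ord p y \<ge> v"
  shows "rat_ord p (x - y) \<ge> v"
  using rat_ord_add_ge[OF assms(1,2), of "- y"] assms(3) by simp

lemma rat_ord_add_eq:
  assumes p: "prime p" and less: "rat_ord p x < rat_ord p y"
  shows "rat_ord p (x + y) = rat_ord p x"
proof (rule antisym)
  show "rat_ord p (x + y) \<ge> rat_ord p x"
    using less by (intro rat_ord_add_ge[OF p]) auto
  have "min (rat_ord p (x + y)) (rat_ord p y) \<le> rat_ord p x"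
    using rat_ord_add[OF p, of "x + y" "- y"] by simp
  then show "rat_ord p (x + y) \<le> rat_ord p x"
    using less by (auto simp: min_def split: if_splits)
qed

section \<open>The \<open>p\<close>-adic numbers\<close>

text \<open>The field of \<open>p\<close>-adic numbers is the completion of the rationals: the set of Cauchy
  sequences for the \<open>p\<close>-adic absolute value, modulo sequences tending to 0. Since \<open>p\<close> is
  a variable, it is a set of equivalence classes rather than a type. The conditions are
  phrased with \<open>rat_ord\<close>, where \<open>rat_ord p x \<ge> \<nu>\<close> means that \<open>x\<close> has
  \<open>p\<close>-adic absolute value at most \<open>p powr (- \<nu>)\<close>.\<close>

definition padic_Cauchy :: "nat \<Rightarrow> (nat \<Rightarrow> rat) \<Rightarrow> bool" where
  "padic_Cauchy p x \<longleftrightarrow>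
     (\<forall>\<nu>::int. \<exists>N. \<forall>m\<ge>N. \<forall>n\<ge>N. rat_ord p (x m - x n) \<ge> ereal (of_int \<nu>))"

definition padic_null :: "nat \<Rightarrow> (nat \<Rightarrow> rat) \<Rightarrow> bool" where
  "padic_null p x \<longleftrightarrow> (\<forall>\<nu>::int. \<exists>N. \<forall>n\<ge>N. rat_ord p (x n) \<ge> ereal (of_int \<nu>))"

definition padic_rel :: "nat \<Rightarrow> ((nat \<Rightarrow> rat) \<times> (nat \<Rightarrow> rat)) set" where
  "padic_rel p = {(x, y). padic_Cauchy p x \<and> padic_Cauchy p y \<and> padic_null p (\<lambda>n. x n - y n)}"

definition padic_numbers :: "nat \<Rightarrow> (nat \<Rightarrow> rat) set set" where
  "padic_numbers p = {x. padic_Cauchy p x} // padic_rel p"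

definition padic_of_rat :: "nat \<Rightarrow> rat \<Rightarrow> (nat \<Rightarrow> rat) set" where
  "padic_of_rat p q = padic_rel p `` {\<lambda>_. q}"

definition padic_minus ::
  "nat \<Rightarrow> (nat \<Rightarrow> rat) set \<Rightarrow> (nat \<Rightarrow> rat) set \<Rightarrow> (nat \<Rightarrow> rat) set" where
  "padic_minus p X Y = (\<Union>x\<in>X. \<Union>y\<in>Y. padic_rel p `` {\<lambda>n. x n - y n})"

text \<open>The valuation is extended to the completion by continuity.\<close>

definition padic_ord :: "nat \<Rightarrow> (nat \<Rightarrow> rat) set \<Rightarrow> ereal" where
  "padic_ord p X = (THE v. \<forall>x\<in>X. (\<lambda>n. rat_ord p (x n)) \<longlonglongrightarrow> v)"

definition padic_integers :: "nat \<Rightarrow> (nat \<Rightarrow> rat) set set" where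
  "padic_integers p = {z \<in> padic_numbers p. padic_ord p z \<ge> 0}"

subsection \<open>Well-definedness\<close>

lemma padic_null_iff_tendsto: "padic_null p x \<longleftrightarrow> (\<lambda>n. rat_ord p (x n)) \<longlonglongrightarrow> \<infinity>"
proof
  assume n: "padic_null p x"
  show "(\<lambda>n. rat_ord p (x n)) \<longlonglongrightarrow> \<infinity>"
    unfolding Lim_PInfty
  proof
    fix r :: real
    obtain N where "\<forall>n\<ge>N. rat_ord p (x n) \<ge> ereal (of_int \<lceil>r\<rceil>)"
      using n unfolding padic_null_def by blast
    then show "\<exists>N. \<forall>n\<ge>N. rat_ord p (x n) \<ge> ereal r"
      by (meson ereal_less_eq(3) le_of_int_ceiling order_trans)
  qed
next
  assume "(\<lambda>n. rat_ord p (x n)) \<longlonglongrightarrow> \<infinity>"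
  then show "padic_null p x"
    unfolding Lim_PInfty padic_null_def by blast
qed

lemma padic_Cauchy_const [simp]: "padic_Cauchy p (\<lambda>_. q)"
  by (simp add: padic_Cauchy_def)

lemma padic_Cauchy_diff:
  assumes p: "prime p" and "padic_Cauchy p x" "padic_Cauchy p y"
  shows "padic_Cauchy p (\<lambda>n. x n - y n)"
  unfolding padic_Cauchy_def
proof
  fix \<nu> :: int
  obtain M where M: "\<forall>m\<ge>M. \<forall>n\<ge>M. rat_ord p (x m - x n) \<ge> ereal (of_int \<nu>)"
    using assms(2) unfolding padic_Cauchy_def by blast
  obtain N where N: "\<forall>m\<ge>N. \<forall>n\<ge>N. rat_ord p (y m - y n) \<ge> ereal (of_int \<nu>)"
    using assms(3) unfolding padic_Cauchy_def by blast
  have "rat_ord p ((x m - y m) - (x n - y n)) \<ge> ereal (of_int \<nu>)"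
    if "m \<ge> max M N" "n \<ge> max M N" for m n
  proof -
    have "rat_ord p ((x m - x n) - (y m - y n)) \<ge> ereal (of_int \<nu>)"
      by (rule rat_ord_diff_ge[OF p]) (use M N that in auto)
    then show ?thesis by (simp add: algebra_simps)
  qed
  then show "\<exists>N. \<forall>m\<ge>N. \<forall>n\<ge>N. rat_ord p (x m - y m - (x n - y n)) \<ge> ereal (of_int \<nu>)"
    by blast
qed

lemma padic_null_diff:
  assumes p: "prime p" and "padic_null p x" "padic_null p y"
  shows "padic_null p (\<lambda>n. x n - y n)"
  unfolding padic_null_def
proof
  fix \<nu> :: int
  obtain M where M: "\<forall>n\<ge>M. rat_ord p (x n) \<ge> ereal (of_int \<nu>)"
    using assms(2) unfolding padic_null_def by blast
  obtain N where N: "\<forall>n\<ge>N. rat_ord p (y n) \<ge> ereal (of_int \<nu>)"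
    using assms(3) unfolding padic_null_def by blast
  have "\<forall>n\<ge>max M N. rat_ord p (x n - y n) \<ge> ereal (of_int \<nu>)"
    by (intro allI impI rat_ord_diff_ge[OF p, of _ "x _" "y _"]) (use M N in auto)
  then show "\<exists>N. \<forall>n\<ge>N. rat_ord p (x n - y n) \<ge> ereal (of_int \<nu>)" by blast
qed

lemma equiv_padic_rel:
  assumes p: "prime p"
  shows "equiv {x. padic_Cauchy p x} (padic_rel p)"
proof (rule equivI)
  show "padic_rel p \<subseteq> {x. padic_Cauchy p x} \<times> {x. padic_Cauchy p x}"
    by (auto simp: padic_rel_def)
  show "refl_on {x. padic_Cauchy p x} (padic_rel p)"
    by (auto simp: refl_on_def padic_rel_def padic_null_def)
  show "sym (padic_rel p)"
    by (auto simp: sym_def padic_rel_def padic_null_def rat_ord_diff_commute)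
  show "trans (padic_rel p)"
  proof (rule transI)
    fix x y z assume xy: "(x, y) \<in> padic_rel p" and yz: "(y, z) \<in> padic_rel p"
    have "padic_null p (\<lambda>n. z n - y n)"
      using yz unfolding padic_rel_def padic_null_def by (auto simp: rat_ord_diff_commute)
    then have "padic_null p (\<lambda>n. (x n - y n) - (z n - y n))"
      by (rule padic_null_diff[OF p, rotated]) (use xy in \<open>simp add: padic_rel_def\<close>)
    then show "(x, z) \<in> padic_rel p" using xy yz by (auto simp: padic_rel_def)
  qed
qed

lemma padic_of_rat_in_numbers: "padic_of_rat p q \<in> padic_numbers p"
  unfolding padic_of_rat_def padic_numbers_def by (rule quotientI) simp

lemma padic_rel_diff:
  assumes p: "prime p" and "(x, x') \<in> padic_rel p" "(y, y') \<in> padic_rel p"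
  shows "((\<lambda>n. x n - y n), (\<lambda>n. x' n - y' n)) \<in> padic_rel p"
proof -
  have "padic_null p (\<lambda>n. (x n - x' n) - (y n - y' n))"
    by (rule padic_null_diff[OF p]) (use assms in \<open>auto simp: padic_rel_def\<close>)
  moreover have "(\<lambda>n. (x n - x' n) - (y n - y' n)) = (\<lambda>n. (x n - y n) - (x' n - y' n))"
    by (simp add: fun_eq_iff)
  ultimately show ?thesis
    using assms padic_Cauchy_diff[OF p] by (simp add: padic_rel_def)
qed

lemma padic_minus_class:
  assumes p: "prime p" and "padic_Cauchy p x" "padic_Cauchy p y"
  shows "padic_minus p (padic_rel p `` {x}) (padic_rel p `` {y})
           = padic_rel p `` {\<lambda>n. x n - y n}"
proof -
  have "congruent2 (padic_rel p) (padic_rel p) (\<lambda>x y. padic_rel p `` {\<lambda>n. x n - y n})"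
    by (rule congruent2I') (rule equiv_class_eq[OF equiv_padic_rel[OF p] padic_rel_diff[OF p]])
  then show ?thesis
    unfolding padic_minus_def
    using assms by (intro UN_equiv_class2[OF equiv_padic_rel[OF p] equiv_padic_rel[OF p]]) auto
qed

lemma rat_ord_convergent:
  assumes p: "prime p" and x: "padic_Cauchy p x"
  shows "\<exists>v. (\<lambda>n. rat_ord p (x n)) \<longlonglongrightarrow> v \<and> 
           (v = \<infinity> \<or> eventually (\<lambda>n. rat_ord p (x n) = v) sequentially)"
proof (cases "padic_null p x")
  case True
  then show ?thesis by (auto simp: padic_null_iff_tendsto)
next
  case False
  then obtain \<nu> :: int where \<nu>: "\<And>N. \<exists>n\<ge>N. rat_ord p (x n) < ereal (of_int \<nu>)"
    unfolding padic_null_def by (auto simp: not_le)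
  obtain N where N: "\<forall>m\<ge>N. \<forall>n\<ge>N. rat_ord p (x m - x n) \<ge> ereal (of_int \<nu>)"
    using x unfolding padic_Cauchy_def by blast
  obtain k where k: "k \<ge> N" "rat_ord p (x k) < ereal (of_int \<nu>)" using \<nu> by blast
  have "rat_ord p (x n) = rat_ord p (x k)" if "n \<ge> N" for n
  proof -
    have "rat_ord p (x k) < rat_ord p (x n - x k)" using N k that by (meson less_le_trans)
    from rat_ord_add_eq[OF p this] show ?thesis by simp
  qed
  then have ev: "eventually (\<lambda>n. rat_ord p (x n) = rat_ord p (x k)) sequentially"
    by (auto simp: eventually_sequentially)
  then show ?thesis using tendsto_eventually[OF ev] by blast
qed

lemma rat_ord_tendsto_cong:
  assumes p: "prime p" and xy: "(x, y) \<in> padic_rel p"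
    and v: "(\<lambda>n. rat_ord p (x n)) \<longlonglongrightarrow> v"
  shows "(\<lambda>n. rat_ord p (y n)) \<longlonglongrightarrow> v"
proof -
  have null: "padic_null p (\<lambda>n. x n - y n)" and x: "padic_Cauchy p x"
    using xy by (auto simp: padic_rel_def)
  obtain w where w: "(\<lambda>n. rat_ord p (x n)) \<longlonglongrightarrow> w"
    "w = \<infinity> \<or> eventually (\<lambda>n. rat_ord p (x n) = w) sequentially"
    using rat_ord_convergent[OF p x] by blast
  have [simp]: "w = v" using LIMSEQ_unique[OF w(1) v] .
  show ?thesis
  proof (cases "v = \<infinity>")
    case True
    then have "padic_null p x" using v by (simp add: padic_null_iff_tendsto)
    then have "padic_null p (\<lambda>n. x n - (x n - y n))" using null by (rule padic_null_diff[OF p])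
    then show ?thesis using True by (simp add: padic_null_iff_tendsto)
  next
    case False
    have "eventually (\<lambda>n. v < rat_ord p (x n - y n)) sequentially"
      using null False unfolding padic_null_iff_tendsto
      by (intro order_tendstoD) auto
    moreover have "eventually (\<lambda>n. rat_ord p (x n) = v) sequentially" using w False by auto
    ultimately have "eventually (\<lambda>n. rat_ord p (y n) = v) sequentially"
    proof eventually_elim
      case (elim n)
      then have "rat_ord p (- x n) < rat_ord p (x n - y n)" by simp
      from rat_ord_add_eq[OF p this] elim show ?case by simp
    qed
    then show ?thesis by (rule tendsto_eventually)
  qed
qed

lemma padic_ord_eqI:
  assumes p: "prime p" and x: "padic_Cauchy p x"
    and v: "(\<lambda>n. rat_ord p (x n)) \<longlonglongrightarrow> v"
  shows "padic_ord p (padic_rel p `` {x}) = v"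
  unfolding padic_ord_def
proof (rule the_equality)
  show "\<forall>y\<in>padic_rel p `` {x}. (\<lambda>n. rat_ord p (y n)) \<longlonglongrightarrow> v"
    using rat_ord_tendsto_cong[OF p _ v] by auto
  fix w assume w: "\<forall>y\<in>padic_rel p `` {x}. (\<lambda>n. rat_ord p (y n)) \<longlonglongrightarrow> w"
  have "x \<in> padic_rel p `` {x}"
    using equiv_class_self[OF equiv_padic_rel[OF p]] x by simp
  with w v show "w = v" using LIMSEQ_unique by blast
qed

lemma padic_ord_tendsto:
  assumes p: "prime p" and X: "X \<in> padic_numbers p" and x: "x \<in> X"
  shows "(\<lambda>n. rat_ord p (x n)) \<longlonglongrightarrow> padic_ord p X"
proof -
  obtain y where y: "X = padic_rel p `` {y}"
    using X unfolding padic_numbers_def by (auto elim: quotientE)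
  with x have yx: "(y, x) \<in> padic_rel p" by simp
  then have X_eq: "X = padic_rel p `` {x}"
    using equiv_class_eq[OF equiv_padic_rel[OF p]] y by simp
  have xC: "padic_Cauchy p x" using yx by (simp add: padic_rel_def)
  obtain v where "(\<lambda>n. rat_ord p (x n)) \<longlonglongrightarrow> v"
    using rat_ord_convergent[OF p xC] by blast
  then show ?thesis using padic_ord_eqI[OF p xC] X_eq by simp
qed

lemma padic_ord_of_rat:
  assumes p: "prime p"
  shows "padic_ord p (padic_of_rat p q) = rat_ord p q"
  unfolding padic_of_rat_def
  using padic_ord_eqI[OF p padic_Cauchy_const tendsto_const] by this

lemma padic_minus_of_rat:
  assumes p: "prime p"
  shows "padic_minus p (padic_of_rat p q) (padic_of_rat p r) = padic_of_rat p (q - r)"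
  unfolding padic_of_rat_def
  using padic_minus_class[OF p padic_Cauchy_const padic_Cauchy_const] by this

section \<open>The distribution of a generation\<close>

definition cw_freq :: "nat \<Rightarrow> nat \<Rightarrow> (nat \<Rightarrow> rat) set \<Rightarrow> int \<Rightarrow> real" where
  "cw_freq p n z \<nu> = 2 powi (1 - int n) *
     real (size {#q \<in># cw_generation n.
       padic_ord p (padic_minus p (padic_of_rat p q) z) \<ge> ereal (of_int \<nu>)#})"

definition cw_mu :: "nat \<Rightarrow> (nat \<Rightarrow> rat) set \<Rightarrow> int \<Rightarrow> real" where
  "cw_mu p z \<nu> = lim (\<lambda>n. cw_freq p n z \<nu>)"

end

theory Submission
  imports Defs "HOL-Number_Theory.Cong"
begin

text \<open>Reducing numerators and denominators modulo \<open>p\<close> turns the Calkin--Wilf tree into a random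
  walk on the \<open>p\<^sup>2 - 1\<close> nonzero vectors of \<open>\<int>/p \<times> \<int>/p\<close> whose two steps \<open>(a, b) \<mapsto> (a, a + b)\<close>
  and \<open>(a, b) \<mapsto> (a + b, b)\<close> are permutations, so that averaging over all vectors is preserved.
  From every vector the walk can reach \<open>(0, 1)\<close> in exactly \<open>2p\<close> steps, so every \<open>2p\<close> steps the
  oscillation of the expected value of a function contracts by the factor \<open>1 - 2\<^sup>-\<^sup>2\<^sup>p\<close> (Doeblin),
  and the walk equidistributes. The condition \<open>ord\<^sub>p (a/b - z) \<ge> 1\<close> selects \<open>p - 1\<close> of the
  vectors, namely a punctured line.\<close>

section \<open>Random walks generated by two permutations\<close>

locale two_permutations =
  fixes S :: "'a set" and step :: "bool \<Rightarrow> 'a \<Rightarrow> 'a"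
  assumes finite_S: "finite S"
    and bij_step: "\<And>d. bij_betw (step d) S S"
begin

text \<open>The expected value of \<open>f\<close> after \<open>n\<close> fair random steps from
  \<open>x\<close>. \<open>foldr\<close> performs the last letter first, just as
  \<open>cw_label\<close> puts the newest edge at the head of the list.\<close>

definition walk_avg :: "nat \<Rightarrow> ('a \<Rightarrow> real) \<Rightarrow> 'a \<Rightarrow> real" where
  "walk_avg n f x = (\<Sum>v | length v = n. f (foldr step v x)) / 2 ^ n"

lemma finite_words: "finite {v :: bool list. length v = n}"
  using finite_lists_length_eq[of "UNIV :: bool set" n] by simp

lemma card_words: "card {v :: bool list. length v = n} = 2 ^ n"
  using card_lists_length_eq[of "UNIV :: bool set" n] by simp

lemma bij_foldr: "bij_betw (foldr step v) S S"
proof (induction v)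
  case Nil
  then show ?case by (simp add: bij_betw_def)
next
  case (Cons d v)
  then show ?case using bij_betw_trans[OF Cons bij_step[of d]] by (simp add: comp_def)
qed

lemma foldr_in_S: "x \<in> S \<Longrightarrow> foldr step v x \<in> S"
  using bij_foldr[of v] by (auto simp: bij_betw_def)

text \<open>The Markov property: condition on the first \<open>m\<close> steps of the walk.\<close>

lemma walk_avg_add:
  "walk_avg (n + m) f x = (\<Sum>v | length v = m. walk_avg n f (foldr step v x)) / 2 ^ m"
proof -
  have "(\<Sum>v | length v = n + m. f (foldr step v x))
      = (\<Sum>(v, u) \<in> {v. length v = m} \<times> {u. length u = n}. f (foldr step u (foldr step v x)))"
    \<comment> \<open>The first \<open>m\<close> steps are the last \<open>m\<close> letters, hence
      \<open>drop n w\<close>.\<close>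
    by (rule sum.reindex_bij_witness
        [of _ "\<lambda>(v, u). u @ v" "\<lambda>w. (drop n w, take n w)"])
      (auto simp: foldr_append[symmetric] simp del: foldr_append)
  also have "\<dots> = (\<Sum>v | length v = m. 2 ^ n * walk_avg n f (foldr step v x))"
    by (simp add: sum.cartesian_product[symmetric] walk_avg_def)
  also have "\<dots> = 2 ^ n * (\<Sum>v | length v = m. walk_avg n f (foldr step v x))"
    by (simp add: sum_distrib_left)
  finally show ?thesis
    unfolding walk_avg_def[of "n + m"] by (simp add: power_add)
qed

text \<open>A mean of numbers in an interval stays there, so bounds valid at one time persist at
  every later time.\<close>

lemma walk_avg_bounds:
  assumes "\<And>x. x \<in> S \<Longrightarrow> walk_avg n f x \<in> {l..u}" "x \<in> S"
  shows "walk_avg (n + m) f x \<in> {l..u}"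
proof -
  have "of_nat (card {v :: bool list. length v = m}) * l
      \<le> (\<Sum>v | length v = m. walk_avg n f (foldr step v x))"
    by (rule sum_bounded_below) (use assms foldr_in_S in auto)
  moreover have "(\<Sum>v | length v = m. walk_avg n f (foldr step v x))
      \<le> of_nat (card {v :: bool list. length v = m}) * u"
    by (rule sum_bounded_above) (use assms foldr_in_S in auto)
  ultimately show ?thesis
    unfolding walk_avg_add card_words by (simp add: field_simps)
qed

text \<open>Every word permutes \<open>S\<close>, so the uniform distribution is stationary; this
  identifies the limit.\<close>

lemma sum_walk_avg: "(\<Sum>x\<in>S. walk_avg n f x) = (\<Sum>x\<in>S. f x)"
proof -
  have "(\<Sum>x\<in>S. walk_avg n f x) = (\<Sum>v | length v = n. \<Sum>x\<in>S. f (foldr step v x)) / 2 ^ n"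
    unfolding walk_avg_def sum_divide_distrib[symmetric] by (subst sum.swap) rule
  also have "\<dots> = (\<Sum>v | length (v :: bool list) = n. \<Sum>x\<in>S. f x) / 2 ^ n"
    by (simp add: sum.reindex_bij_betw[OF bij_foldr])
  finally show ?thesis by (simp add: card_words)
qed

text \<open>Of the \<open>2 ^ N\<close> words, \<open>w\<close> contributes the value at
  \<open>s\<close> and the other \<open>2 ^ N - 1\<close> contribute values between \<open>l\<close>
  and \<open>u\<close>. The offset does not depend on \<open>x\<close>, so only the shrunken
  interval matters.\<close>

lemma walk_avg_hit:
  assumes bounds: "\<And>x. x \<in> S \<Longrightarrow> walk_avg n f x \<in> {l..u}" and x: "x \<in> S"
    and w: "length w = N" "foldr step w x = s"
  shows "walk_avg (n + N) f x \<in>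
    {(1 - 1 / 2 ^ N) * l + walk_avg n f s / 2 ^ N .. (1 - 1 / 2 ^ N) * u + walk_avg n f s / 2 ^ N}"
proof -
  let ?W = "{v. length v = N} - {w}"
  have weight: "(1 - 1 / 2 ^ N) * r = (2 ^ N - 1) * r / 2 ^ N" for r :: real
    by (simp add: field_simps)
  have split: "(\<Sum>v | length v = N. walk_avg n f (foldr step v x))
      = walk_avg n f s + (\<Sum>v\<in>?W. walk_avg n f (foldr step v x))"
    using w by (subst sum.remove[of _ w]) (auto simp: finite_words)
  have card: "real (card ?W) = 2 ^ N - 1"
    using w by (simp add: finite_words card_words of_nat_diff)
  have "of_nat (card ?W) * l \<le> (\<Sum>v\<in>?W. walk_avg n f (foldr step v x))"
    by (rule sum_bounded_below) (use bounds x foldr_in_S in auto)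
  moreover have "(\<Sum>v\<in>?W. walk_avg n f (foldr step v x)) \<le> of_nat (card ?W) * u"
    by (rule sum_bounded_above) (use bounds x foldr_in_S in auto)
  ultimately show ?thesis
    unfolding walk_avg_add split card weight add_divide_distrib
    by (auto intro!: divide_right_mono)
qed

text \<open>\<open>walk_avg_hit\<close> iterated: the offset \<open>?e\<close> is common to all
  starting points, so one interval serves all of \<open>S\<close> and its length shrinks by a fixed
  factor every \<open>N\<close> steps.\<close>

lemma walk_avg_oscillation:
  assumes hit: "\<And>x. x \<in> S \<Longrightarrow> \<exists>w. length w = N \<and> foldr step w x = s"
    and f: "\<And>x. x \<in> S \<Longrightarrow> f x \<in> {0..1}"
  shows "\<exists>l u. u - l = (1 - 1 / 2 ^ N) ^ k \<and> (\<forall>x\<in>S. walk_avg (k * N) f x \<in> {l..u})"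
proof (induction k)
  case 0
  have "\<forall>x\<in>S. walk_avg (0 * N) f x \<in> {0..1}" using f by (simp add: walk_avg_def)
  then show ?case by (intro exI[of _ 0] exI[of _ 1]) simp
next
  case (Suc k)
  then obtain l u where lu: "u - l = (1 - 1 / 2 ^ N) ^ k"
    "\<forall>x\<in>S. walk_avg (k * N) f x \<in> {l..u}" by blast
  let ?e = "walk_avg (k * N) f s / 2 ^ N"
  have "\<forall>x\<in>S. walk_avg (Suc k * N) f x \<in> {(1 - 1 / 2 ^ N) * l + ?e..(1 - 1 / 2 ^ N) * u + ?e}"
  proof
    fix x assume x: "x \<in> S"
    then obtain w where "length w = N" "foldr step w x = s" using hit by blast
    then show "walk_avg (Suc k * N) f x \<in> {(1 - 1 / 2 ^ N) * l + ?e..(1 - 1 / 2 ^ N) * u + ?e}"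
      using walk_avg_hit[of "k * N" f l u x w N s] lu x by (simp add: add.commute)
  qed
  moreover have "((1 - 1 / 2 ^ N) * u + ?e) - ((1 - 1 / 2 ^ N) * l + ?e)
      = (1 - 1 / 2 ^ N) * (u - l)" by (simp only: right_diff_distrib add_diff_cancel_right)
  ultimately show ?case unfolding lu(1) by (metis power_Suc)
qed

lemma walk_avg_tendsto:
  assumes hit: "\<And>x. x \<in> S \<Longrightarrow> \<exists>w. length w = N \<and> foldr step w x = s"
    and f: "\<And>x. x \<in> S \<Longrightarrow> f x \<in> {0..1}" and x: "x \<in> S"
  shows "(\<lambda>n. walk_avg n f x) \<longlonglongrightarrow> (\<Sum>x\<in>S. f x) / card S"
proof (rule LIMSEQ_I)
  fix r :: real assume r: "r > 0"
  have card: "card S > 0" using x finite_S by (auto simp: card_gt_0_iff)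
  have "(\<lambda>k. (1 - 1 / 2 ^ N :: real) ^ k) \<longlonglongrightarrow> 0"
    by (rule LIMSEQ_realpow_zero) auto
  then obtain k where k: "(1 - 1 / 2 ^ N :: real) ^ k < r"
    using r by (metis eventually_happens order_tendstoD(2) sequentially_bot)
  obtain l u where lu: "u - l = (1 - 1 / 2 ^ N) ^ k"
    "\<And>y. y \<in> S \<Longrightarrow> walk_avg (k * N) f y \<in> {l..u}"
    using walk_avg_oscillation[of N s f k] hit f by blast
  have "norm (walk_avg n f x - (\<Sum>x\<in>S. f x) / card S) < r" if "n \<ge> k * N" for n
  proof -
    have b: "walk_avg n f y \<in> {l..u}" if "y \<in> S" for y
      using walk_avg_bounds[of "k * N" f l u y "n - k * N"] lu(2) that \<open>n \<ge> k * N\<close> by simp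
    have "of_nat (card S) * l \<le> (\<Sum>y\<in>S. walk_avg n f y)"
      by (rule sum_bounded_below) (use b in auto)
    moreover have "(\<Sum>y\<in>S. walk_avg n f y) \<le> of_nat (card S) * u"
      by (rule sum_bounded_above) (use b in auto)
    \<comment> \<open>By stationarity the mean of \<open>f\<close> is also the mean of the walk
      averages, so it lies in the same short interval as each of them.\<close>
    ultimately have "(\<Sum>x\<in>S. f x) / card S \<in> {l..u}"
      using card by (simp add: sum_walk_avg field_simps)
    then show ?thesis using b[OF x] lu(1) k by (auto simp: abs_if)
  qed
  then show "\<exists>no. \<forall>n\<ge>no. norm (walk_avg n f x - (\<Sum>x\<in>S. f x) / card S) < r" by blast
qed

end

section \<open>The walk on nonzero vectors modulo \<open>p\<close>\<close>

definition nonzero_vecs :: "nat \<Rightarrow> (int \<times> int) set" where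
  "nonzero_vecs p = {0..<int p} \<times> {0..<int p} - {(0, 0)}"

fun vec_step :: "nat \<Rightarrow> bool \<Rightarrow> int \<times> int \<Rightarrow> int \<times> int" where
  "vec_step p d (a, b) = (if d then ((a + b) mod int p, b) else (a, (a + b) mod int p))"

lemma finite_nonzero_vecs: "finite (nonzero_vecs p)"
  by (simp add: nonzero_vecs_def)

lemma card_nonzero_vecs:
  assumes "p > 0"
  shows "card (nonzero_vecs p) = p ^ 2 - 1"
  using assms by (simp add: nonzero_vecs_def card_Diff_singleton power2_eq_square)

lemma mod_add_left_cancel_residues:
  fixes a b c m :: int
  assumes "(a + b) mod m = (a + c) mod m" "b \<in> {0..<m}" "c \<in> {0..<m}"
  shows "b = c"
proof -
  have "b mod m = c mod m"
    using assms(1) by (metis add_diff_cancel_left' mod_diff_left_eq)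
  then show ?thesis using assms(2,3) by simp
qed

text \<open>A shear is injective on all residue pairs and fixes the origin, so it maps the finite
  set of nonzero vectors injectively into itself.\<close>

lemma vec_step_bij:
  assumes p: "p > 0"
  shows "bij_betw (vec_step p d) (nonzero_vecs p) (nonzero_vecs p)"
proof -
  have inj: "inj_on (vec_step p d) ({0..<int p} \<times> {0..<int p})"
  proof (rule inj_onI)
    fix x y assume xy: "x \<in> {0..<int p} \<times> {0..<int p}" "y \<in> {0..<int p} \<times> {0..<int p}"
      "vec_step p d x = vec_step p d y"
    obtain a b where x: "x = (a, b)" by fastforce
    obtain a' b' where y: "y = (a', b')" by fastforce
    show "x = y"
    proof (cases d)
      case True
      then have "b = b'" "(b + a) mod int p = (b + a') mod int p"
        using xy(3) by (auto simp: x y add.commute)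
      then show ?thesis using mod_add_left_cancel_residues[of b a "int p" a'] xy by (simp add: x y)
    next
      case False
      then have "a = a'" "(a + b) mod int p = (a + b') mod int p"
        using xy(3) by (auto simp: x y)
      then show ?thesis using mod_add_left_cancel_residues[of a b "int p" b'] xy by (simp add: x y)
    qed
  qed
  have "vec_step p d x \<in> nonzero_vecs p" if x: "x \<in> nonzero_vecs p" for x
  proof -
    have "vec_step p d (0, 0) = (0, 0)" by simp
    moreover have "x \<noteq> (0, 0)" using x by (simp add: nonzero_vecs_def)
    moreover have "(0, 0) \<in> {0..<int p} \<times> {0..<int p}" "x \<in> {0..<int p} \<times> {0..<int p}"
      using x p by (auto simp: nonzero_vecs_def)
    ultimately have "vec_step p d x \<noteq> (0, 0)" using inj_onD[OF inj] by metis
    then show ?thesis using x p by (cases x) (auto simp: nonzero_vecs_def)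
  qed
  moreover have "inj_on (vec_step p d) (nonzero_vecs p)"
    using inj by (rule inj_on_subset) (auto simp: nonzero_vecs_def)
  ultimately show ?thesis
    using endo_inj_surj[OF finite_nonzero_vecs, of "vec_step p d" p]
    by (simp add: bij_betw_def image_subsetI)
qed

section \<open>Reaching \<open>(0, 1)\<close> from every nonzero vector\<close>

lemma vec_step_True_funpow:
  assumes "a \<in> {0..<int p}"
  shows "(vec_step p True ^^ k) (a, b) = ((a + int k * b) mod int p, b)"
  using assms by (induction k) (auto simp: mod_simps algebra_simps)

lemma vec_step_False_funpow:
  assumes "b \<in> {0..<int p}"
  shows "(vec_step p False ^^ k) (a, b) = (a, (b + int k * a) mod int p)"
  using assms by (induction k) (auto simp: mod_simps algebra_simps)

lemma ex_translate_mod_prime: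
  fixes a b c :: int
  assumes p: "prime p" and a: "a \<in> {0<..<int p}" and c: "c \<in> {0..<int p}"
  shows "\<exists>k<p. (b + int k * a) mod int p = c"
proof -
  have "\<not> int p dvd a" using a by (auto dest: zdvd_imp_le)
  then have "coprime a (int p)"
    using p by (metis coprime_commute prime_imp_coprime prime_nat_int_transfer)
  then obtain e where e: "[a * e = 1] (mod int p)" using cong_solve_coprime_int by blast
  \<comment> \<open>The residue of \<open>(c - b) / a\<close>, with \<open>e\<close> as the inverse
    of \<open>a\<close> modulo \<open>p\<close>.\<close>
  define k where "k = nat (((c - b) * e) mod int p)"
  have p0: "int p > 0" using a by simp
  have k: "int k = ((c - b) * e) mod int p" using p0 by (simp add: k_def)
  have "[b + int k * a = b + (c - b) * e * a] (mod int p)"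
    unfolding k by (intro cong_add cong_mult cong_refl) (simp add: cong_def)
  then have "[b + int k * a = b + (c - b) * (a * e)] (mod int p)"
    by (simp only: mult_ac)
  also have "[b + (c - b) * (a * e) = b + (c - b) * 1] (mod int p)"
    by (intro cong_add cong_mult e cong_refl)
  finally have "(b + int k * a) mod int p = c" using c by (simp add: cong_def)
  moreover have "k < p" using k p0 by (metis of_nat_less_iff pos_mod_bound)
  ultimately show ?thesis by blast
qed

text \<open>If \<open>a\<close> is nonzero, adding it to \<open>b\<close> repeatedly gives
  \<open>(a, 1)\<close>, and then adding 1 to \<open>a\<close> repeatedly gives
  \<open>(0, 1)\<close>. The contraction argument needs one word length for all starting vectors,
  hence the padding to \<open>2 * p\<close>.\<close>

lemma vec_walk_hits:
  assumes p: "prime p" and x: "x \<in> nonzero_vecs p"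
  shows "\<exists>w. length w = 2 * p \<and> foldr (vec_step p) w x = (0, 1)"
proof -
  have p1: "p > 1" using p by (rule prime_gt_1_nat)
  have from_nz: "\<exists>w. length w < 2 * p \<and> foldr (vec_step p) w (a, b) = (0, 1)"
    if a: "a \<in> {0<..<int p}" and b: "b \<in> {0..<int p}" for a b
  proof -
    obtain k where k: "k < p" "(b + int k * a) mod int p = 1"
      using ex_translate_mod_prime[OF p a, of 1 b] p1 by auto
    obtain j where j: "j < p" "(a + int j * 1) mod int p = 0"
      using ex_translate_mod_prime[OF p, of 1 0 a] p1 by auto
    \<comment> \<open>The \<open>False\<close> block stands on the right and so acts first.\<close>
    have "foldr (vec_step p) (replicate j True @ replicate k False) (a, b) = (0, 1)"
      using a b k j by (simp add: vec_step_True_funpow vec_step_False_funpow)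
    then show ?thesis
      using k j by (intro exI[of _ "replicate j True @ replicate k False"] conjI) auto
  qed
  obtain a b where ab: "x = (a, b)" by fastforce
  have "\<exists>w. length w \<le> 2 * p \<and> foldr (vec_step p) w x = (0, 1)"
  proof (cases "a = 0")
    case False
    then show ?thesis using from_nz[of a b] x by (force simp: ab nonzero_vecs_def)
  next
    case True
    then have b: "b \<in> {0<..<int p}" using x by (auto simp: ab nonzero_vecs_def)
    obtain w where w: "length w < 2 * p" "foldr (vec_step p) w (b, b) = (0, 1)"
      using from_nz[of b b] b by auto
    \<comment> \<open>The appended letter acts first and moves \<open>(0, b)\<close> to
      \<open>(b, b)\<close>, whose first entry is nonzero.\<close>
    have "foldr (vec_step p) (w @ [True]) x = (0, 1)" using w b True by (simp add: ab)
    then show ?thesis using w(1) by (intro exI[of _ "w @ [True]"]) auto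
  qed
  then obtain w where w: "length w \<le> 2 * p" "foldr (vec_step p) w x = (0, 1)" by blast
  \<comment> \<open>\<open>(0, 1)\<close> is fixed by the \<open>False\<close> step, so waiting
    there costs nothing.\<close>
  have "foldr (vec_step p) (replicate (2 * p - length w) False @ w) x = (0, 1)"
    using w p1 by (simp add: vec_step_False_funpow)
  then show ?thesis
    using w(1) by (intro exI[of _ "replicate (2 * p - length w) False @ w"] conjI) auto
qed

text \<open>Since \<open>d\<close> is invertible modulo \<open>p\<close>, the line is a graph over
  \<open>b\<close>; \<open>b = 0\<close> would give the excluded origin, which leaves
  \<open>p - 1\<close> choices.\<close>

lemma card_line_vecs:
  assumes p: "prime p" and d: "\<not> int p dvd d"
  shows "card {(a, b) \<in> nonzero_vecs p. int p dvd a * d - c * b} = p - 1"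
proof -
  have p0: "int p > 0" using prime_gt_0_nat[OF p] by simp
  have cop: "coprime d (int p)"
    using p d by (metis coprime_commute prime_imp_coprime prime_nat_int_transfer)
  then obtain e where e: "[d * e = 1] (mod int p)" using cong_solve_coprime_int by blast
  have iff: "int p dvd a * d - c * b \<longleftrightarrow> a = (c * e * b) mod int p" if "a \<in> {0..<int p}" for a b
  proof -
    have "[(c * e * b) * d = c * b] (mod int p)"
      using cong_mult[OF e cong_refl[of "c * b"]] by (simp add: mult_ac)
    then have "int p dvd a * d - c * b \<longleftrightarrow> [a * d = (c * e * b) * d] (mod int p)"
      unfolding cong_iff_dvd_diff[symmetric] by (meson cong_sym cong_trans)
    also have "\<dots> \<longleftrightarrow> [a = c * e * b] (mod int p)"
      using cop by (rule cong_mult_rcancel)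
    finally show ?thesis using that by (simp add: cong_def)
  qed
  have "{(a, b) \<in> nonzero_vecs p. int p dvd a * d - c * b}
      = (\<lambda>b. ((c * e * b) mod int p, b)) ` {1..<int p}"
  proof (rule set_eqI, clarify)
    fix a b
    show "(a, b) \<in> {(a, b) \<in> nonzero_vecs p. int p dvd a * d - c * b} \<longleftrightarrow>
        (a, b) \<in> (\<lambda>b. ((c * e * b) mod int p, b)) ` {1..<int p}" (is "?l \<longleftrightarrow> ?r")
    proof
      assume l: ?l
      then have "a = (c * e * b) mod int p" "b \<in> {0..<int p}"
        using iff[of a b] by (auto simp: nonzero_vecs_def)
      moreover from this have "b \<noteq> 0" using l by (auto simp: nonzero_vecs_def)
      ultimately show ?r by force
    next
      assume r: ?r
      then have "a \<in> {0..<int p}" using p0 by auto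
      then show ?l using iff[of a b] r by (auto simp: nonzero_vecs_def)
    qed
  qed
  also have "card \<dots> = p - 1"
    by (subst card_image) (auto simp: inj_on_def)
  finally show ?thesis .
qed

section \<open>Labels of the tree modulo \<open>p\<close>\<close>

text \<open>Both children of a reduced positive fraction are already reduced, so no cancellation
  occurs and the integer step on numerator and denominator descends to residues.\<close>

lemma cw_label_vec_walk:
  assumes p: "p > 1"
  shows "\<exists>a b. a > 0 \<and> b > 0 \<and> quotient_of (cw_label v) = (a, b) \<and>
    foldr (vec_step p) v (1, 1) = (a mod int p, b mod int p)"
proof (induction v)
  case Nil
  then show ?case using p by simp
next
  case (Cons d v)
  then obtain a b where ab: "a > 0" "b > 0" "quotient_of (cw_label v) = (a, b)"
    "foldr (vec_step p) v (1, 1) = (a mod int p, b mod int p)" by blast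
  have "coprime a b" using quotient_of_coprime[OF ab(3)] .
  then have "coprime (a + b) b" "coprime a (a + b)"
    by (simp_all add: coprime_iff_gcd_eq_1)
  then show ?case
    using ab by (auto simp: cw_left_def cw_right_def quotient_of_Fract normalize_stable mod_simps)
qed

section \<open>The valuation condition as a congruence\<close>

text \<open>The difference is \<open>(a * d - c * b) / (b * d)\<close>. Its denominator can only
  lower the valuation, which gives one direction; for the other it has to be prime to
  \<open>p\<close>.\<close>

lemma rat_ord_diff_ge_1_iff:
  assumes p: "prime p" and q: "quotient_of q = (a, b)" and w: "quotient_of w = (c, d)"
    and wp: "\<not> int p dvd d"
  shows "rat_ord p (q - w) \<ge> 1 \<longleftrightarrow> int p dvd a * d - c * b"
proof -
  have pos: "b > 0" "d > 0" using quotient_of_denom_pos[OF q] quotient_of_denom_pos[OF w] .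
  have eq: "q - w = of_int (a * d - c * b) / of_int (b * d)"
    unfolding quotient_of_div[OF q] quotient_of_div[OF w] using pos by (simp add: field_simps)
  let ?m = "multiplicity (int p)"
  have pp: "prime (int p)" using p by simp
  then have nu: "\<not> is_unit (int p)" using not_prime_unit by blast
  show ?thesis
  proof (cases "a * d - c * b = 0")
    case True
    then show ?thesis by (simp add: eq)
  next
    case False
    have "?m (b * d) = ?m b"
      using pp pos wp by (simp add: prime_elem_multiplicity_mult_distrib not_dvd_imp_multiplicity_0)
    then have ord: "rat_ord p (q - w) = ereal (real (?m (a * d - c * b)) - real (?m b))"
      unfolding eq using pos False by (subst rat_ord_divide[OF p]) auto
    show ?thesis
    proof
      assume "rat_ord p (q - w) \<ge> 1"
      then have "?m (a * d - c * b) \<noteq> 0" by (auto simp: ord one_ereal_def)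
      then show "int p dvd a * d - c * b" by (metis not_dvd_imp_multiplicity_0)
    next
      assume dvd: "int p dvd a * d - c * b"
      \<comment> \<open>Otherwise \<open>p\<close> would divide \<open>a * d\<close>, hence
        \<open>a\<close>, and the fraction \<open>a / b\<close> would not be reduced.\<close>
      have "\<not> int p dvd b"
      proof
        assume b: "int p dvd b"
        then have "int p dvd a * d" using dvd_add[OF dvd dvd_mult[OF b, of c]] by simp
        then have "int p dvd a" using wp pp by (simp add: prime_dvd_mult_iff)
        then show False
          using b coprime_common_divisor[OF quotient_of_coprime[OF q]] nu by blast
      qed
      then have "?m b = 0" by (rule not_dvd_imp_multiplicity_0)
      moreover have "?m (a * d - c * b) \<ge> 1"
        using dvd False pp nu by (intro multiplicity_geI) simp_all
      ultimately show "rat_ord p (q - w) \<ge> 1" by (simp add: ord one_ereal_def)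
    qed
  qed
qed

lemma rat_ord_nonneg_imp:
  assumes p: "prime p" and w: "quotient_of w = (c, d)" and nonneg: "rat_ord p w \<ge> 0"
  shows "\<not> int p dvd d"
proof
  assume dvd: "int p dvd d"
  have pp: "prime (int p)" using p by simp
  then have nu: "\<not> is_unit (int p)" using not_prime_unit by blast
  have "\<not> int p dvd c"
    using dvd coprime_common_divisor[OF quotient_of_coprime[OF w]] nu by blast
  moreover from this have "w \<noteq> 0" using w by auto
  moreover have "multiplicity (int p) d \<ge> 1"
    using dvd pp quotient_of_denom_pos[OF w] nu
    by (intro multiplicity_geI) simp_all
  ultimately show False
    using nonneg w by (simp add: rat_ord_def not_dvd_imp_multiplicity_0 zero_ereal_def)
qed

text \<open>A late term of a Cauchy sequence representing \<open>z\<close> serves as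
  \<open>w\<close>: it is integral and agrees with all later terms modulo \<open>p\<close>, so by
  the ultrametric inequality it can replace \<open>z\<close> in the condition.\<close>

lemma padic_integer_approx:
  assumes p: "prime p" and z: "z \<in> padic_integers p"
  shows "\<exists>w. rat_ord p w \<ge> 0 \<and>
    (\<forall>q. padic_ord p (padic_minus p (padic_of_rat p q) z) \<ge> 1 \<longleftrightarrow> rat_ord p (q - w) \<ge> 1)"
proof -
  obtain x where x: "padic_Cauchy p x" "z = padic_rel p `` {x}"
    using z unfolding padic_integers_def padic_numbers_def by (auto elim: quotientE)
  obtain v where v: "(\<lambda>n. rat_ord p (x n)) \<longlonglongrightarrow> v"
    "v = \<infinity> \<or> eventually (\<lambda>n. rat_ord p (x n) = v) sequentially"
    using rat_ord_convergent[OF p x(1)] by blast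
  have "v \<ge> 0"
    using z padic_ord_eqI[OF p x(1) v(1)] by (simp add: padic_integers_def x(2))
  from v(2) have "eventually (\<lambda>n. rat_ord p (x n) \<ge> 0) sequentially"
  proof
    assume "v = \<infinity>"
    then have "eventually (\<lambda>n. rat_ord p (x n) > 0) sequentially"
      using v(1) by (intro order_tendstoD) auto
    then show ?thesis by eventually_elim auto
  next
    assume "eventually (\<lambda>n. rat_ord p (x n) = v) sequentially"
    then show ?thesis by eventually_elim (use \<open>v \<ge> 0\<close> in auto)
  qed
  then obtain N where N: "\<And>n. n \<ge> N \<Longrightarrow> rat_ord p (x n) \<ge> 0"
    by (auto simp: eventually_sequentially)
  obtain M where "\<forall>m\<ge>M. \<forall>n\<ge>M. rat_ord p (x m - x n) \<ge> ereal (of_int 1)"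
    using x(1) unfolding padic_Cauchy_def by blast
  then have M: "\<And>m n. m \<ge> M \<Longrightarrow> n \<ge> M \<Longrightarrow> rat_ord p (x m - x n) \<ge> 1"
    by (simp flip: one_ereal_def)
  define K where "K = max M N"
  have "padic_ord p (padic_minus p (padic_of_rat p q) z) \<ge> 1 \<longleftrightarrow> rat_ord p (q - x K) \<ge> 1" for q
  proof -
    have C: "padic_Cauchy p (\<lambda>n. q - x n)" using padic_Cauchy_diff[OF p padic_Cauchy_const x(1)] .
    obtain t where t: "(\<lambda>n. rat_ord p (q - x n)) \<longlonglongrightarrow> t" using rat_ord_convergent[OF p C] by blast
    have "padic_ord p (padic_minus p (padic_of_rat p q) z) = t"
      unfolding padic_of_rat_def x(2) padic_minus_class[OF p padic_Cauchy_const x(1)]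
      using padic_ord_eqI[OF p C t] .
    moreover have "t \<ge> 1 \<longleftrightarrow> rat_ord p (q - x K) \<ge> 1"
    proof
      assume "rat_ord p (q - x K) \<ge> 1"
      then have "rat_ord p (q - x n) \<ge> 1" if "n \<ge> K" for n
        using rat_ord_add_ge[OF p, of 1 "q - x K" "x K - x n"] M[of K n] that by (simp add: K_def)
      then show "t \<ge> 1" by (intro LIMSEQ_le_const[OF t]) auto
    next
      assume t1: "t \<ge> 1"
      show "rat_ord p (q - x K) \<ge> 1"
      proof (rule ccontr)
        assume less: "\<not> rat_ord p (q - x K) \<ge> 1"
        \<comment> \<open>Of two unequal valuations the smaller one is that of the sum, so the
          sequence is constant from \<open>K\<close> on and its limit stays below 1.\<close>
        have "rat_ord p (q - x n) = rat_ord p (q - x K)" if "n \<ge> K" for n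
        proof -
          have "rat_ord p (q - x K) < rat_ord p (x K - x n)"
            by (rule less_le_trans[of _ 1]) (use less M[of K n] that in \<open>simp_all add: K_def not_le\<close>)
          from rat_ord_add_eq[OF p this] show ?thesis by simp
        qed
        then have "(\<lambda>n. rat_ord p (q - x n)) \<longlonglongrightarrow> rat_ord p (q - x K)"
          by (intro tendsto_eventually eventually_sequentiallyI)
        then have "t = rat_ord p (q - x K)" using LIMSEQ_unique[OF t] by simp
        then show False using t1 less by simp
      qed
    qed
    ultimately show ?thesis by simp
  qed
  moreover have "rat_ord p (x K) \<ge> 0" using N[of K] by (simp add: K_def)
  ultimately show ?thesis by blast
qed

section \<open>Equidistribution applied to the tree\<close>

theorem theorem9:
  fixes p :: nat and z :: "(nat \<Rightarrow> rat) set"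
  assumes "prime p" and "z \<in> padic_integers p"
  shows "convergent (\<lambda>n. cw_freq p n z 1) \<and> cw_mu p z 1 = 1 / (real p + 1)"
proof -
  note p = assms(1)
  have p1: "p > 1" using p by (rule prime_gt_1_nat)
  interpret two_permutations "nonzero_vecs p" "vec_step p"
    using p1 by unfold_locales (auto intro!: finite_nonzero_vecs vec_step_bij)
  obtain w where w: "rat_ord p w \<ge> 0"
    "\<And>q. padic_ord p (padic_minus p (padic_of_rat p q) z) \<ge> 1 \<longleftrightarrow> rat_ord p (q - w) \<ge> 1"
    using padic_integer_approx[OF assms] by blast
  obtain c d where cd: "quotient_of w = (c, d)" by fastforce
  have d: "\<not> int p dvd d" using rat_ord_nonneg_imp[OF p cd w(1)] .
  \<comment> \<open>The indicator of the line on which \<open>a / b\<close> is congruent to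
    \<open>w\<close> modulo \<open>p\<close>; it depends only on the residues of \<open>a\<close>
    and \<open>b\<close>.\<close>
  define f :: "int \<times> int \<Rightarrow> real" where "f = (\<lambda>(a, b). of_bool (int p dvd a * d - c * b))"
  have f_label: "f (foldr (vec_step p) v (1, 1)) =
      of_bool (padic_ord p (padic_minus p (padic_of_rat p (cw_label v)) z) \<ge> 1)" for v
  proof -
    obtain a b where ab: "quotient_of (cw_label v) = (a, b)"
      "foldr (vec_step p) v (1, 1) = (a mod int p, b mod int p)"
      using cw_label_vec_walk[OF p1] by blast
    have "(a mod int p * d - c * (b mod int p)) mod int p = (a * d - c * b) mod int p"
      by (intro mod_diff_cong) (simp_all add: mod_simps)
    then have "int p dvd a mod int p * d - c * (b mod int p) \<longleftrightarrow> int p dvd a * d - c * b"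
      by (simp add: dvd_eq_mod_eq_0)
    then show ?thesis
      using rat_ord_diff_ge_1_iff[OF p ab(1) cd d] by (simp add: f_def ab(2) w(2))
  qed
  \<comment> \<open>Generation \<open>Suc n\<close> consists of the words of length
    \<open>n\<close>, and its normalisation is \<open>2 powi (- int n)\<close>.\<close>
  have freq: "cw_freq p (Suc n) z 1 = walk_avg n f (1, 1)" for n
  proof -
    have "size {#q \<in># cw_generation (Suc n).
        padic_ord p (padic_minus p (padic_of_rat p q) z) \<ge> 1#} =
      card {v \<in> {v. length v = n}.
        padic_ord p (padic_minus p (padic_of_rat p (cw_label v)) z) \<ge> 1}"
      by (simp add: cw_generation_def filter_mset_image_mset finite_words)
    also have "real \<dots> = (\<Sum>v | length v = n. f (foldr (vec_step p) v (1, 1)))"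
      by (simp add: f_label sum.If_cases finite_words of_bool_def Int_def)
    finally show ?thesis
      by (simp add: cw_freq_def walk_avg_def power_int_minus field_simps flip: one_ereal_def)
  qed
  have "(\<Sum>x\<in>nonzero_vecs p. f x) = real (p - 1)"
  proof -
    have "(\<Sum>x\<in>nonzero_vecs p. f x) =
        real (card {(a, b) \<in> nonzero_vecs p. int p dvd a * d - c * b})"
      by (simp add: f_def of_bool_def sum.If_cases finite_nonzero_vecs case_prod_unfold Int_def)
    then show ?thesis using card_line_vecs[OF p d] by simp
  qed
  moreover have "real (card (nonzero_vecs p)) = (real p - 1) * (real p + 1)"
    using p1 by (simp add: card_nonzero_vecs of_nat_diff power2_eq_square algebra_simps)
  ultimately have lim_eq: "(\<Sum>x\<in>nonzero_vecs p. f x) / card (nonzero_vecs p) = 1 / (real p + 1)"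
    using p1 by (simp add: of_nat_diff)
  \<comment> \<open>The walk starts at the residues of the root 1/1.\<close>
  have "(1, 1) \<in> nonzero_vecs p" using p1 by (simp add: nonzero_vecs_def)
  then have "(\<lambda>n. cw_freq p (Suc n) z 1) \<longlonglongrightarrow> 1 / (real p + 1)"
    unfolding freq lim_eq[symmetric]
    by (intro walk_avg_tendsto[OF vec_walk_hits[OF p]]) (auto simp: f_def)
  \<comment> \<open>Undoing the index shift only brings back the empty generation 0.\<close>
  then have "(\<lambda>n. cw_freq p n z 1) \<longlonglongrightarrow> 1 / (real p + 1)"
    by (rule LIMSEQ_imp_Suc)
  then show ?thesis by (auto simp: cw_mu_def convergent_def limI)
qed

end
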